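(* Let $t=2m'+1\ge3$ be odd, $r\ge2$, $R'=m'+r$, $\Lambda=(\Lambda_1\ge\dots\ge\Lambda_{R'}\ge0)$ integers, $X\in\mathbb Z^r$, and let $M=M(\Lambda,X)$ be the $R'\times R'$ matrix defined in the context, with $V_i=2\Lambda_i+2(R'-i)+1$. For each row $i$ let $c_i\in\{0,1,\dots,m'\}$ and $\sigma_i\in\{\pm1\}$ be the unique pair with $\sigma_iV_i\equiv c_i\pmod t$ (with $\sigma_i=+1$ when $c_i=0$), and set $w_i=\sigma_iV_i$. For each column $j$ set $\tau_j=+1$ if $j$ is frozen, and otherwise let $b_j\in\{0,\dots,m'\}$ and $\tau_j\in\{\pm1\}$ be the unique pair with $X_j\equiv\tau_jb_j\pmod t$, with $\tau_j=+1$ when $b_j=0$. Let $\pi$ order the rows by $(c_i,w_i)$ increasing lexicographically. Then $$\widehat M_{\pi(i),j}:=\sigma_i\,\tau_j\,M_{i,j}$$ is a $0/1$ matrix whose ones are consecutive in every column. Consequently $M$ is totally unimodular.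
   Context: Folding: the folded class of an integer $a$ is the unique $c\in\{0,\dots,m'\}$ with $a\equiv\pm c\pmod t$; its folding sign is $+1$ if $a\equiv c\pmod t$ and $-1$ otherwise. $M(\Lambda,X)$: rows indexed by $i=1,\dots,R'$; columns are $m'$ frozen slots followed by $r$ free slots. For $1\le p\le m'$ the $p$-th frozen column has in row $i$ the folding sign of $V_i$ if $V_i$ has folded class $m'-p+1$, and $0$ otherwise. For a free slot attached to the coordinate $X_j$ of $X$ ($1\le j\le r$), the entry in row $i$ is the sum of those $\varepsilon\in\{\pm1\}$ with $\varepsilon V_i=X_j+tk$ for some odd integer $k\ge1$ ($0$ if there is none). A matrix is totally unimodular if every square submatrix has determinant in $\{0,\pm1\}$. *)

theory Defs
  imports
    "Jordan_Normal_Form.Determinant"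
    "Jordan_Normal_Form.DL_Submatrix"
    "HOL-Number_Theory.Cong"
    "HOL-Combinatorics.Permutations"
begin

(* Throughout, m stands for m', R for R' and modulus m for t = 2 m' + 1.  Rows, columns and the
   coordinates of \<Lambda> and X are numbered from 1; values of \<Lambda> and X outside 1..R resp. 1..r are
   irrelevant. *)

definition modulus :: "nat \<Rightarrow> int" where
  "modulus m = 2 * int m + 1"

definition folded_class :: "nat \<Rightarrow> int \<Rightarrow> int" where
  "folded_class m a =
     (THE c. c \<in> {0..int m} \<and> ([a = c] (mod modulus m) \<or> [a = - c] (mod modulus m)))"

definition folding_sign :: "nat \<Rightarrow> int \<Rightarrow> int" where
  "folding_sign m a = (if [a = folded_class m a] (mod modulus m) then 1 else - 1)"

definition V :: "nat \<Rightarrow> (nat \<Rightarrow> int) \<Rightarrow> nat \<Rightarrow> int" where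
  "V R \<Lambda> i = 2 * \<Lambda> i + 2 * (int R - int i) + 1"

(* Column p with 1 \<le> p \<le> m is the p-th frozen slot; column m + j with 1 \<le> j \<le> r is the free slot
   attached to X j. *)
definition M_entry :: "nat \<Rightarrow> nat \<Rightarrow> (nat \<Rightarrow> int) \<Rightarrow> (nat \<Rightarrow> int) \<Rightarrow> nat \<Rightarrow> nat \<Rightarrow> int" where
  "M_entry m r \<Lambda> X i j =
     (let v = V (m + r) \<Lambda> i in
      if j \<le> m
      then (if folded_class m v = int m - int j + 1 then folding_sign m v else 0)
      else (\<Sum>\<epsilon> | \<epsilon> \<in> {1, - 1} \<and>
              (\<exists>k::int. odd k \<and> k \<ge> 1 \<and> \<epsilon> * v = X (j - m) + modulus m * k). \<epsilon>))"

(* The library's matrices are numbered from 0, hence the shift. *)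
definition M_mat :: "nat \<Rightarrow> nat \<Rightarrow> (nat \<Rightarrow> int) \<Rightarrow> (nat \<Rightarrow> int) \<Rightarrow> int mat" where
  "M_mat m r \<Lambda> X = mat (m + r) (m + r) (\<lambda>(i, j). M_entry m r \<Lambda> X (Suc i) (Suc j))"

definition totally_unimodular :: "int mat \<Rightarrow> bool" where
  "totally_unimodular A \<longleftrightarrow>
     (\<forall>I J. I \<subseteq> {..<dim_row A} \<longrightarrow> J \<subseteq> {..<dim_col A} \<longrightarrow> card I = card J \<longrightarrow>
        det (submatrix A I J) \<in> {- 1, 0, 1})"

(* (c_i, \<sigma>_i) = row_pair m (V_i) and (b_j, \<tau>_j) = col_pair m (X_j). *)
definition row_pair :: "nat \<Rightarrow> int \<Rightarrow> int \<times> int" where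
  "row_pair m a = (THE p. case p of (c, s) \<Rightarrow>
     c \<in> {0..int m} \<and> s \<in> {1, - 1} \<and> [s * a = c] (mod modulus m) \<and> (c = 0 \<longrightarrow> s = 1))"

definition col_pair :: "nat \<Rightarrow> int \<Rightarrow> int \<times> int" where
  "col_pair m a = (THE p. case p of (b, s) \<Rightarrow>
     b \<in> {0..int m} \<and> s \<in> {1, - 1} \<and> [a = s * b] (mod modulus m) \<and> (b = 0 \<longrightarrow> s = 1))"

definition orders_rows :: "nat \<Rightarrow> (nat \<Rightarrow> int) \<Rightarrow> (nat \<Rightarrow> int) \<Rightarrow> (nat \<Rightarrow> nat) \<Rightarrow> bool" where
  "orders_rows R c w \<pi> \<longleftrightarrow> \<pi> permutes {1..R} \<and>
     (\<forall>i\<in>{1..R}. \<forall>k\<in>{1..R}. c i < c k \<or> c i = c k \<and> w i < w k \<longrightarrow> \<pi> i < \<pi> k)"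


text \<open>The objects above introduced by a definite description or by an ordering condition exist
  and are unique.\<close>

lemma modulus_small:
  assumes "modulus m dvd x" "\<bar>x\<bar> \<le> 2 * int m"
  shows "x = 0"
  using assms dvd_imp_le_int[of x "modulus m"] by (auto simp: modulus_def)

lemma ex1_row_pair:
  "\<exists>!p. case p of (c, s) \<Rightarrow>
     c \<in> {0..int m} \<and> s \<in> {1, - 1} \<and> [s * a = c] (mod modulus m) \<and> (c = 0 \<longrightarrow> s = 1)"
  (is "\<exists>!p. ?P p")
proof (rule ex_ex1I)
  define r where "r = a mod modulus m"
  have r: "0 \<le> r" "r \<le> 2 * int m"
    using pos_mod_bound[of "modulus m" a] unfolding r_def by (simp_all add: modulus_def)
  have dv: "modulus m dvd a - r" unfolding r_def by simp
  show "\<exists>p. ?P p"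
  proof (cases "r \<le> int m")
    case True
    then show ?thesis using r dv by (intro exI[of _ "(r, 1)"]) (auto simp: cong_iff_dvd_diff)
  next
    case False
    have "modulus m dvd - (a - r) - modulus m"
      by (rule dvd_diff[OF iffD2[OF dvd_minus_iff dv] dvd_refl])
    moreover have "- (a - r) - modulus m = - a - (modulus m - r)" by simp
    ultimately have "modulus m dvd - a - (modulus m - r)" by metis
    then show ?thesis using False r
      by (intro exI[of _ "(modulus m - r, - 1)"]) (auto simp: cong_iff_dvd_diff modulus_def)
  qed
next
  fix p q assume "?P p" "?P q"
  moreover obtain c s where p: "p = (c, s)" by force
  moreover obtain d u where q: "q = (d, u)" by force
  ultimately have P: "c \<in> {0..int m}" "s \<in> {1, - 1}" "modulus m dvd s * a - c" "c = 0 \<longrightarrow> s = 1"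
    and Q: "d \<in> {0..int m}" "u \<in> {1, - 1}" "modulus m dvd u * a - d" "d = 0 \<longrightarrow> u = 1"
    by (auto simp: cong_iff_dvd_diff)
  show "p = q"
  proof (cases "s = u")
    case True
    have "modulus m dvd (u * a - d) - (s * a - c)" by (rule dvd_diff[OF Q(3) P(3)])
    then have "c - d = 0" using P Q True by (intro modulus_small[of m]) auto
    then show ?thesis using True p q by simp
  next
    case False
    then have s: "u = - s" using P Q by auto
    have "modulus m dvd (u * a - d) + (s * a - c)" by (rule dvd_add[OF Q(3) P(3)])
    then have "- d - c = 0" using P Q s by (intro modulus_small[of m]) auto
    then have "c = 0" "d = 0" using P Q by auto
    then show ?thesis using P Q p q by simp
  qed
qed

lemma ex1_col_pair:
  "\<exists>!p. case p of (b, s) \<Rightarrow>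
     b \<in> {0..int m} \<and> s \<in> {1, - 1} \<and> [a = s * b] (mod modulus m) \<and> (b = 0 \<longrightarrow> s = 1)"
proof -
  have "[a = s * b] (mod modulus m) \<longleftrightarrow> [s * a = b] (mod modulus m)" if "s \<in> {1, - 1}" for b s
  proof -
    have "modulus m dvd a + b \<longleftrightarrow> modulus m dvd - a - b"
      using dvd_minus_iff[of "modulus m" "a + b"] by simp
    then show ?thesis using that by (auto simp: cong_iff_dvd_diff)
  qed
  then have "(case p of (b, s) \<Rightarrow>
      b \<in> {0..int m} \<and> s \<in> {1, - 1} \<and> [a = s * b] (mod modulus m) \<and> (b = 0 \<longrightarrow> s = 1)) \<longleftrightarrow>
    (case p of (b, s) \<Rightarrow>
      b \<in> {0..int m} \<and> s \<in> {1, - 1} \<and> [s * a = b] (mod modulus m) \<and> (b = 0 \<longrightarrow> s = 1))" for p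
    by (cases p) blast
  then show ?thesis using ex1_row_pair[of m a] by presburger
qed

lemma ex1_folded_class:
  "\<exists>!c. c \<in> {0..int m} \<and> ([a = c] (mod modulus m) \<or> [a = - c] (mod modulus m))"
proof (rule ex_ex1I)
  show "\<exists>c. c \<in> {0..int m} \<and> ([a = c] (mod modulus m) \<or> [a = - c] (mod modulus m))"
    using ex1_implies_ex[OF ex1_col_pair[of m a]] by fastforce
next
  fix c d
  assume c: "c \<in> {0..int m} \<and> ([a = c] (mod modulus m) \<or> [a = - c] (mod modulus m))"
    and d: "d \<in> {0..int m} \<and> ([a = d] (mod modulus m) \<or> [a = - d] (mod modulus m))"
  have uniq: "p = q" if
    "case p of (b, s) \<Rightarrow>
      b \<in> {0..int m} \<and> s \<in> {1, - 1} \<and> [a = s * b] (mod modulus m) \<and> (b = 0 \<longrightarrow> s = 1)"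
    "case q of (b, s) \<Rightarrow>
      b \<in> {0..int m} \<and> s \<in> {1, - 1} \<and> [a = s * b] (mod modulus m) \<and> (b = 0 \<longrightarrow> s = 1)" for p q
    using ex1_col_pair[of m a] that by blast
  obtain s where s: "case (c, s) of (b, s) \<Rightarrow>
      b \<in> {0..int m} \<and> s \<in> {1, - 1} \<and> [a = s * b] (mod modulus m) \<and> (b = 0 \<longrightarrow> s = 1)"
    using c by (cases "[a = c] (mod modulus m)") (force intro: that[of 1], force intro: that[of "- 1"])
  obtain u where u: "case (d, u) of (b, s) \<Rightarrow>
      b \<in> {0..int m} \<and> s \<in> {1, - 1} \<and> [a = s * b] (mod modulus m) \<and> (b = 0 \<longrightarrow> s = 1)"
    using d by (cases "[a = d] (mod modulus m)") (force intro: that[of 1], force intro: that[of "- 1"])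
  show "c = d" using uniq[OF s u] by simp
qed

lemma ex1_orders_rows:
  assumes inj: "inj_on (\<lambda>i. (c i, w i)) {1..R}"
  shows "\<exists>!\<pi>. orders_rows R c w \<pi>"
proof -
  define S where "S = {1..R}"
  define le where "le k i \<longleftrightarrow> c k < c i \<or> c k = c i \<and> w k \<le> w i" for k i
  define rk where "rk i = (if i \<in> S then card {k \<in> S. le k i} else i)" for i
  have fin: "finite S" by (simp add: S_def)
  have less: "rk i < rk k" if "i \<in> S" "k \<in> S" "c i < c k \<or> c i = c k \<and> w i < w k" for i k
  proof -
    have "{l \<in> S. le l i} \<subset> {l \<in> S. le l k}"
      using that unfolding le_def by (intro psubsetI; force)
    then show ?thesis using fin that by (simp add: rk_def psubset_card_mono)
  qed
  have total: "(c i < c k \<or> c i = c k \<and> w i < w k) \<or> (c k < c i \<or> c k = c i \<and> w k < w i)"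
    if "i \<in> S" "k \<in> S" "i \<noteq> k" for i k
    proof -
    have "c i \<noteq> c k \<or> w i \<noteq> w k" using inj_onD[OF inj, of i k] that unfolding S_def by auto
    then show ?thesis by linarith
  qed
  have "inj_on rk S"
  proof (rule inj_onI, rule ccontr)
    fix i k assume "i \<in> S" "k \<in> S" "rk i = rk k" "i \<noteq> k"
    then show False using total[of i k] less[of i k] less[of k i] by auto
  qed
  moreover have "rk ` S \<subseteq> S"
  proof
    fix x assume "x \<in> rk ` S"
    then obtain i where i: "i \<in> S" "x = rk i" by blast
    have "i \<in> {k \<in> S. le k i}" using i by (simp add: le_def)
    then have "0 < card {k \<in> S. le k i}" using fin by (subst card_gt_0_iff) auto
    moreover have "card {k \<in> S. le k i} \<le> card S" using fin by (intro card_mono) auto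
    ultimately show "x \<in> S" using i by (simp add: rk_def S_def)
  qed
  ultimately have "bij_betw rk S S"
    using fin by (simp add: bij_betw_def endo_inj_surj)
  then have "rk permutes S" by (intro bij_imp_permutes) (auto simp: rk_def)
  then have ex: "orders_rows R c w rk"
    using less by (auto simp: orders_rows_def S_def)
  have "\<pi> = rk" if \<pi>: "orders_rows R c w \<pi>" for \<pi>
  proof
    fix i
    have perm: "\<pi> permutes S" using \<pi> by (simp add: orders_rows_def S_def)
    have mono: "\<pi> i < \<pi> k" if "i \<in> S" "k \<in> S" "c i < c k \<or> c i = c k \<and> w i < w k" for i k
      using \<pi> that by (auto simp: orders_rows_def S_def)
    show "\<pi> i = rk i"
    proof (cases "i \<in> S")
      case False
      then show ?thesis using perm by (simp add: rk_def permutes_not_in)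
    next
      case True
      have iff: "le k i \<longleftrightarrow> \<pi> k \<le> \<pi> i" if "k \<in> S" for k
      proof (cases "k = i")
        case False
        then show ?thesis
          using total[OF that True False] mono[OF that True] mono[OF True that] unfolding le_def by force
      qed (simp add: le_def)
      have "\<pi> i \<in> S" using perm True by (simp add: permutes_in_image)
      then have sub: "{1..\<pi> i} \<subseteq> S" by (auto simp: S_def)
      have "\<pi> ` {k \<in> S. le k i} = {1..\<pi> i}"
      proof
        show "\<pi> ` {k \<in> S. le k i} \<subseteq> {1..\<pi> i}"
          using iff permutes_in_image[OF perm] by (force simp: S_def)
        show "{1..\<pi> i} \<subseteq> \<pi> ` {k \<in> S. le k i}"
        proof
          fix x assume x: "x \<in> {1..\<pi> i}"
          then obtain k where k: "k \<in> S" "x = \<pi> k"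
            using sub permutes_image[OF perm] by blast
          then show "x \<in> \<pi> ` {k \<in> S. le k i}" using x iff by auto
        qed
      qed
      then have "card {k \<in> S. le k i} = \<pi> i"
        using card_image[of \<pi> "{k \<in> S. le k i}"] permutes_inj_on[OF perm] by simp
      then show ?thesis using True by (simp add: rk_def)
    qed
  qed
  with ex show ?thesis by blast
qed

lemma inj_on_row_keys:
  assumes anti: "\<forall>i\<in>{1..<R}. \<Lambda> (i + 1) \<le> \<Lambda> i" and nonneg: "\<forall>i\<in>{1..R}. 0 \<le> \<Lambda> i"
    and \<sigma>: "\<forall>i\<in>{1..R}. \<sigma> i = snd (row_pair m (V R \<Lambda> i))"
    and w: "\<forall>i\<in>{1..R}. w i = \<sigma> i * V R \<Lambda> i"
  shows "inj_on (\<lambda>i. (c i, w i)) {1..R}"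
proof (rule inj_onI)
  have pos: "V R \<Lambda> i > 0" if "i \<in> {1..R}" for i
    using nonneg that by (fastforce simp: V_def)
  have mono: "\<Lambda> k \<le> \<Lambda> i" if "i \<le> k" "1 \<le> i" "k \<le> R" for i k
    using that
  proof (induction k rule: dec_induct)
    case (step n)
    then have "\<Lambda> (n + 1) \<le> \<Lambda> n" using anti by simp
    then show ?case using step by simp
  qed simp
  have less: "V R \<Lambda> k < V R \<Lambda> i" if "i < k" "i \<in> {1..R}" "k \<in> {1..R}" for i k
    using mono[of i k] that by (simp add: V_def)
  have sign: "\<bar>w i\<bar> = V R \<Lambda> i" if i: "i \<in> {1..R}" for i
  proof -
    have "snd (row_pair m (V R \<Lambda> i)) \<in> {1, - 1}"
      using theI'[OF ex1_row_pair[of m "V R \<Lambda> i"]] unfolding row_pair_def[symmetric]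
      by (auto simp: case_prod_unfold)
    then show ?thesis using pos[OF i] \<sigma> w i by (auto simp: abs_mult)
  qed
  fix i k assume ik: "i \<in> {1..R}" "k \<in> {1..R}" "(c i, w i) = (c k, w k)"
  then have "V R \<Lambda> i = V R \<Lambda> k" using sign[of i] sign[of k] by simp
  then show "i = k" using less[of i k] less[of k i] ik by (cases i k rule: linorder_cases) auto
qed

end

theory Submission
  imports Defs
begin

text \<open>After the sign changes, a column only sees the rows of one class \<open>c\<close>, and among these it
  selects those with \<open>w\<close> in a convex set (a half-line for a free slot), so its ones are consecutive.
  The determinant of an interval matrix is computed by elimination: among the columns that are
  nonzero in the first row, subtract the shortest from all the others.  The results are again
  intervals, and expansion along the first row leaves a smaller interval matrix.\<close>

section \<open>Residue pairs and folding\<close>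

lemma row_pair_eqI:
  assumes "c \<in> {0..int m}" "s \<in> {1, - 1}" "modulus m dvd s * a - c" "c = 0 \<longrightarrow> s = 1"
  shows "row_pair m a = (c, s)"
  unfolding row_pair_def
  by (rule the1_equality[OF ex1_row_pair]) (use assms in \<open>simp add: cong_iff_dvd_diff\<close>)

lemma row_pairD:
  assumes "(c, s) = row_pair m a"
  shows "c \<in> {0..int m}" "s \<in> {1, - 1}" "modulus m dvd s * a - c" "c = 0 \<longrightarrow> s = 1"
  using theI'[OF ex1_row_pair[of m a]] unfolding row_pair_def[symmetric] assms[symmetric]
  by (simp_all add: cong_iff_dvd_diff)

lemma col_pairD:
  assumes "(b, u) = col_pair m x"
  shows "b \<in> {0..int m}" "u \<in> {1, - 1}" "modulus m dvd x - u * b" "b = 0 \<longrightarrow> u = 1"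
  using theI'[OF ex1_col_pair[of m x]] unfolding col_pair_def[symmetric] assms[symmetric]
  by (simp_all add: cong_iff_dvd_diff)

lemma folded_class_row_pair:
  assumes "(c, s) = row_pair m a"
  shows "folded_class m a = c"
  unfolding folded_class_def
proof (rule the1_equality[OF ex1_folded_class])
  have "modulus m dvd - (a + c) \<longleftrightarrow> modulus m dvd a + c" by (rule dvd_minus_iff)
  then show "c \<in> {0..int m} \<and> ([a = c] (mod modulus m) \<or> [a = - c] (mod modulus m))"
    using row_pairD[OF assms] by (auto simp: cong_iff_dvd_diff algebra_simps)
qed

text \<open>If \<open>a\<close> is congruent to \<open>c\<close>, then \<open>(c, 1)\<close> meets
  the description of \<open>row_pair m a\<close> and uniqueness forces \<open>s = 1\<close>;
  otherwise \<open>s = 1\<close> is impossible. So the sign cancelling a frozen entry is the entry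
  itself.\<close>

lemma folding_sign_row_pair:
  assumes "(c, s) = row_pair m a" "c \<noteq> 0"
  shows "folding_sign m a = s"
proof (cases "modulus m dvd a - c")
  case True
  then have "row_pair m a = (c, 1)"
    using row_pairD[OF assms(1)] by (intro row_pair_eqI) auto
  then show ?thesis
    using assms True by (simp add: folding_sign_def folded_class_row_pair cong_iff_dvd_diff)
next
  case False
  then have "s \<noteq> 1" using row_pairD(3)[OF assms(1)] by auto
  then show ?thesis
    using row_pairD(2)[OF assms(1)] False folded_class_row_pair[OF assms(1)]
    by (simp add: folding_sign_def cong_iff_dvd_diff)
qed

section \<open>Signed entries of frozen and free columns\<close>

lemma frozen_entry:
  assumes "(c, s) = row_pair m (V (m + r) \<Lambda> i)" "j \<in> {1..m}"
  shows "s * M_entry m r \<Lambda> X i j = of_bool (c = int m - int j + 1)"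
  \<comment> \<open>For \<open>j\<close> in \<open>{1..m}\<close> the class
    \<open>int m - int j + 1\<close> is at least 1, so a nonzero entry is the folding sign
    \<open>s\<close>, and \<open>s * s = 1\<close>.\<close>
  using assms folded_class_row_pair[OF assms(1)] folding_sign_row_pair[OF assms(1)]
    row_pairD(2)[OF assms(1)]
  by (auto simp: M_entry_def Let_def)

text \<open>Multiplying by \<open>u\<close> turns the congruence of \<open>e * v\<close> and
  \<open>x\<close> into one of \<open>(u * e) * v\<close> and \<open>b\<close>, so for nonzero
  \<open>b\<close> uniqueness makes \<open>(b, u * e)\<close> the row pair of \<open>v\<close>. In
  class 0 both \<open>v\<close> and \<open>x\<close> are multiples of the modulus and either sign
  \<open>e\<close> works.\<close>

lemma modulus_dvd_iff:
  assumes "(c, s) = row_pair m v" "(b, u) = col_pair m x" "e \<in> {1, - 1}"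
  shows "modulus m dvd e * v - x \<longleftrightarrow> c = b \<and> (b = 0 \<or> e = s * u)"
proof
  note cp = col_pairD[OF assms(2)]
  have uu: "u * u = 1" using cp(2) by auto
  assume "modulus m dvd e * v - x"
  then have "modulus m dvd u * (e * v - x + (x - u * b))"
    using cp(3) by (intro dvd_mult dvd_add)
  then have *: "modulus m dvd (u * e) * v - b"
    using uu by (simp add: algebra_simps)
  have ue: "u * e \<in> {1, - 1}" using cp(2) assms(3) by auto
  show "c = b \<and> (b = 0 \<or> e = s * u)"
  proof (cases "b = 0")
    case True
    then have "modulus m dvd e * ((u * e) * v)" using * by simp
    then have "modulus m dvd v" using assms(3) cp(2) by auto
    then have "row_pair m v = (0, 1)" by (intro row_pair_eqI) auto
    then show ?thesis using True assms(1) by simp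
  next
    case False
    then have "row_pair m v = (b, u * e)" using * ue cp(1) by (intro row_pair_eqI) auto
    then show ?thesis using assms(1) uu by simp
  qed
next
  note rp = row_pairD[OF assms(1)] and cp = col_pairD[OF assms(2)]
  assume R: "c = b \<and> (b = 0 \<or> e = s * u)"
  show "modulus m dvd e * v - x"
  proof (cases "b = 0")
    case True
    then have "modulus m dvd v" "modulus m dvd x" using rp cp R by auto
    then show ?thesis by (intro dvd_diff dvd_mult)
  next
    case False
    then have "e * v - x = u * (s * v - c) - (x - u * b)" using R by (simp add: algebra_simps)
    then show ?thesis using rp(3) cp(3) by (metis dvd_diff dvd_mult)
  qed
qed

text \<open>Since \<open>v\<close> and the modulus are odd, a solution \<open>k\<close> is odd exactly when \<open>x\<close> is even.\<close>

lemma ex_odd_multiple_iff: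
  assumes "odd v" "e \<in> {1, - 1}"
  shows "(\<exists>k::int. odd k \<and> k \<ge> 1 \<and> e * v = x + modulus m * k) \<longleftrightarrow>
    even x \<and> modulus m dvd e * v - x \<and> x + modulus m \<le> e * v"
proof
  have ev: "odd (e * v)" using assms by auto
  have om: "odd (modulus m)" and pm: "modulus m > 0" by (simp_all add: modulus_def)
  {
    assume "\<exists>k::int. odd k \<and> k \<ge> 1 \<and> e * v = x + modulus m * k"
    then obtain k where k: "odd k" "k \<ge> 1" "e * v = x + modulus m * k" by blast
    have "even x" using k(1,3) ev om by (metis even_add even_mult_iff)
    moreover have "modulus m * 1 \<le> modulus m * k" using k(2) pm by (intro mult_left_mono) auto
    ultimately show "even x \<and> modulus m dvd e * v - x \<and> x + modulus m \<le> e * v"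
      using k(3) by simp
  next
    assume R: "even x \<and> modulus m dvd e * v - x \<and> x + modulus m \<le> e * v"
    then obtain k where k: "e * v - x = modulus m * k" by (auto elim: dvdE)
    have "odd (e * v - x)" using R ev by simp
    then have "odd k" unfolding k by auto
    moreover have "modulus m * 1 \<le> modulus m * k" using R k by linarith
    then have "1 \<le> k" using pm by (simp only: mult_le_cancel_left_pos)
    ultimately show "\<exists>k::int. odd k \<and> k \<ge> 1 \<and> e * v = x + modulus m * k"
      using k by (intro exI[of _ k]) simp
  }
qed

text \<open>For \<open>b = 0\<close> both signs can contribute, and then they cancel; this gives the last condition.\<close>

lemma free_entry:
  assumes rp: "(c, s) = row_pair m v" and cp: "(b, u) = col_pair m x" and v: "odd v" "v > 0"
  shows "s * u * (\<Sum>e | e \<in> {1, - 1} \<and>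
      (\<exists>k::int. odd k \<and> k \<ge> 1 \<and> e * v = x + modulus m * k). e) =
    of_bool (c = b \<and> even x \<and> x + modulus m \<le> u * (s * v) \<and>
      (b = 0 \<longrightarrow> - (x + modulus m) < s * v))"
proof -
  \<comment> \<open>\<open>Q e\<close> restates, without the quantifier over \<open>k\<close>, when
    the sign \<open>e\<close> enters the sum.\<close>
  define Q where "Q e \<longleftrightarrow> even x \<and> (c = b \<and> (b = 0 \<or> e = s * u)) \<and> x + modulus m \<le> e * v" for e
  have "{e. e \<in> {1, - 1} \<and> (\<exists>k::int. odd k \<and> k \<ge> 1 \<and> e * v = x + modulus m * k)} =
      {e \<in> {1, - 1}. Q e}"
  proof (intro Collect_cong conj_cong refl)
    fix e :: int assume "e \<in> {1, - 1}"
    then show "(\<exists>k::int. odd k \<and> k \<ge> 1 \<and> e * v = x + modulus m * k) \<longleftrightarrow> Q e"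
      by (simp only: Q_def ex_odd_multiple_iff[OF v(1)] modulus_dvd_iff[OF rp cp])
  qed
  moreover have "(\<Sum>e \<in> {e \<in> {1, - 1}. Q e}. e) = of_bool (Q 1) - of_bool (Q (- 1))"
    by (subst sum.inter_filter) auto
  ultimately have eq: "(\<Sum>e | e \<in> {1, - 1} \<and>
      (\<exists>k::int. odd k \<and> k \<ge> 1 \<and> e * v = x + modulus m * k). e) = of_bool (Q 1) - of_bool (Q (- 1))"
    by simp
  \<comment> \<open>For nonzero \<open>b\<close> only \<open>e = s * u\<close> can contribute, and
    the prefactor makes its contribution 1. For \<open>b = c = 0\<close> both outer signs are 1.
    Since \<open>v > 0\<close>, \<open>Q (- 1)\<close> implies \<open>Q 1\<close>, so the difference
    is 1 exactly when \<open>Q 1\<close> holds and \<open>x + modulus m \<le> - v\<close>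
    fails.\<close>
  have "s = 1 \<or> s = - 1" "u = 1 \<or> u = - 1" "c = 0 \<longrightarrow> s = 1" "b = 0 \<longrightarrow> u = 1"
    using row_pairD[OF rp] col_pairD[OF cp] by auto
  then show ?thesis
    unfolding eq Q_def using v(2) by (elim disjE) (auto simp: of_bool_def)
qed

section \<open>From the lexicographic order to consecutive positions\<close>

lemma orders_rows_convex_image:
  assumes \<pi>: "orders_rows R c w \<pi>"
    and P: "\<And>x y z. P x \<Longrightarrow> P z \<Longrightarrow> x \<le> y \<Longrightarrow> y \<le> z \<Longrightarrow> P y"
  shows "\<exists>a b. \<pi> ` {i \<in> {1..R}. c i = d \<and> P (w i)} = {a..b}"
proof -
  define S where "S = {i \<in> {1..R}. c i = d \<and> P (w i)}"
  have perm: "\<pi> permutes {1..R}" using \<pi> by (simp add: orders_rows_def)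
  have mono: "\<not> (c i < c k \<or> c i = c k \<and> w i < w k)"
    if "i \<in> {1..R}" "k \<in> {1..R}" "\<pi> k \<le> \<pi> i" for i k
    using \<pi> that unfolding orders_rows_def by (meson not_less)
  show ?thesis
  proof (cases "S = {}")
    case True
    \<comment> \<open>Any interval with reversed ends represents the empty set.\<close>
    then have "\<pi> ` S = {1..0}" by simp
    then show ?thesis unfolding S_def by blast
  next
    case False
    have fin: "finite (\<pi> ` S)" by (simp add: S_def)
    obtain i where i: "i \<in> S" "\<pi> i = Min (\<pi> ` S)" using Min_in[OF fin] False by fastforce
    obtain k where k: "k \<in> S" "\<pi> k = Max (\<pi> ` S)" using Max_in[OF fin] False by fastforce
    \<comment> \<open>A row placed between the first and the last row of \<open>S\<close> has its
      key lexicographically between theirs. Both ends have class \<open>d\<close>, so this row has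
      class \<open>d\<close> too and its \<open>w\<close> lies between the end values, where
      convexity of \<open>P\<close> applies.\<close>
    have "{\<pi> i..\<pi> k} \<subseteq> \<pi> ` S"
    proof
      fix p assume p: "p \<in> {\<pi> i..\<pi> k}"
      have "\<pi> i \<in> {1..R}" "\<pi> k \<in> {1..R}"
        using i(1) k(1) permutes_in_image[OF perm] by (auto simp: S_def)
      then have "p \<in> \<pi> ` {1..R}" using p permutes_image[OF perm] by auto
      then obtain l where l: "l \<in> {1..R}" "p = \<pi> l" by blast
      have ci: "c i = d" "P (w i)" "i \<in> {1..R}" and ck: "c k = d" "P (w k)" "k \<in> {1..R}"
        using i(1) k(1) by (auto simp: S_def)
      have "\<not> (c l < c i \<or> c l = c i \<and> w l < w i)" "\<not> (c k < c l \<or> c k = c l \<and> w k < w l)"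
        using mono[OF l(1) ci(3)] mono[OF ck(3) l(1)] p l(2) by auto
      then have "c l = d" "w i \<le> w l" "w l \<le> w k" using ci(1) ck(1) by auto
      then show "p \<in> \<pi> ` S" using l P[OF ci(2) ck(2)] by (auto simp: S_def)
    qed
    moreover have "\<pi> ` S \<subseteq> {\<pi> i..\<pi> k}" using fin by (auto simp: i k)
    ultimately show ?thesis unfolding S_def by blast
  qed
qed

section \<open>Determinants of signed interval matrices\<close>

lemma det_add_multiples_of_col:
  fixes A :: "'a :: comm_ring_1 mat"
  assumes A: "A \<in> carrier_mat n n" and k: "k < n" "k \<notin> S" and "finite S"
  shows "det (mat n n (\<lambda>(i, j). if j \<in> S then A $$ (i, j) + f j * A $$ (i, k) else A $$ (i, j))) =
    det A"
  using \<open>finite S\<close> k(2)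
proof (induction S)
  case empty
  have "mat n n (\<lambda>(i, j). if j \<in> {} then A $$ (i, j) + f j * A $$ (i, k) else A $$ (i, j)) = A"
    using A by (intro eq_matI) auto
  then show ?case by simp
next
  case (insert l S)
  let ?B = "\<lambda>S. mat n n (\<lambda>(i, j). if j \<in> S then A $$ (i, j) + f j * A $$ (i, k) else A $$ (i, j))"
  have IH: "det (?B S) = det A" using insert by simp
  have B: "?B S \<in> carrier_mat n n" by simp
  \<comment> \<open>Column \<open>k\<close> lies outside \<open>S\<close>, so it is still the
    original one when the next multiple is added.\<close>
  have "?B (insert l S) = addcol (f l) l k (?B S)"
    using insert.hyps insert.prems k(1) by (intro eq_matI) (auto simp: add.commute)
  then show ?case using det_addcol[OF k(1) _ B, of l "f l"] insert.prems IH by auto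
qed

text \<open>Labelling rows by \<open>\<rho>\<close> instead of sorting them lets a minor inherit the
  form by restricting the labels. Half-open intervals are used because cutting an initial piece off
  one leaves another, in any linear order. The signs \<open>s\<close> and \<open>t\<close> are
  carried along so that the induction applies directly to signed matrices.\<close>

lemma det_signed_interval_mat:
  fixes A :: "'a :: comm_ring_1 mat" and \<rho> :: "nat \<Rightarrow> 'k :: linorder"
  assumes "A \<in> carrier_mat n n"
    and "\<And>i. i < n \<Longrightarrow> s i \<in> {1, - 1}" and "\<And>j. j < n \<Longrightarrow> t j \<in> {1, - 1}"
    and "\<And>i j. i < n \<Longrightarrow> j < n \<Longrightarrow> A $$ (i, j) = s i * t j * of_bool (\<rho> i \<in> {l j..<u j})"
  shows "det A \<in> {- 1, 0, 1}"
  using assms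
proof (induction n arbitrary: A s t \<rho> l u)
  case 0
  then show ?case by (simp add: det_dim_zero)
next
  case (Suc n)
  note A = Suc.prems(1) and s = Suc.prems(2) and t = Suc.prems(3) and entry = Suc.prems(4)
  \<comment> \<open>Row \<open>k\<close>, with the least label, acts as the first row.\<close>
  obtain k where k: "k < Suc n" "\<And>i. i < Suc n \<Longrightarrow> \<rho> k \<le> \<rho> i"
    using arg_min_if_finite(1)[of "{..<Suc n}" \<rho>] arg_min_least[of "{..<Suc n}" _ \<rho>]
    by (metis empty_iff finite_lessThan lessThan_iff zero_less_Suc)
  define J where "J = {j. j < Suc n \<and> \<rho> k \<in> {l j..<u j}}"
  have finJ: "finite J" by (simp add: J_def)
  show ?case
  proof (cases "J = {}")
    case True
    then have "A $$ (k, j) = 0" if "j < Suc n" for j using entry[OF k(1) that] that by (auto simp: J_def)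
    then have "det A = 0"
      by (subst laplace_expansion_row[OF A k(1)]) simp
    then show ?thesis by simp
  next
    case False
    \<comment> \<open>All intervals indexed by \<open>J\<close> contain the least label, so the one
      with the least upper end selects the fewest rows.\<close>
    obtain q where q: "q \<in> J" "\<And>j. j \<in> J \<Longrightarrow> u q \<le> u j"
      using arg_min_if_finite(1)[OF finJ False, of u] arg_min_least[OF finJ False, of _ u] by blast
    have qn: "q < Suc n" using q by (simp add: J_def)
    \<comment> \<open>Subtracting column \<open>q\<close> removes the labels below
      \<open>u q\<close>, so the new lower end is \<open>u q\<close>. The coefficient
      \<open>- t j * t q\<close> aligns the column signs, as \<open>t q * t q = 1\<close>.\<close>
    define l' where "l' j = (if j \<in> J - {q} then u q else l j)" for j
    define B where "B = mat (Suc n) (Suc n) (\<lambda>(i, j). if j \<in> J - {q}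
      then A $$ (i, j) + (- t j * t q) * A $$ (i, q) else A $$ (i, j))"
    have B: "B \<in> carrier_mat (Suc n) (Suc n)" by (simp add: B_def)
    have detB: "det B = det A"
      unfolding B_def by (rule det_add_multiples_of_col[OF A qn]) (use finJ in auto)
    have Bentry: "B $$ (i, j) = s i * t j * of_bool (\<rho> i \<in> {l' j..<u j})"
      if ij: "i < Suc n" "j < Suc n" for i j
    proof (cases "j \<in> J - {q}")
      case True
      \<comment> \<open>No label lies below \<open>\<rho> k\<close>, so both lower ends are met by
        every row and only the upper ends decide.\<close>
      have "\<rho> k \<le> \<rho> i" "u q \<le> u j" "l j \<le> \<rho> k" "l q \<le> \<rho> k" "\<rho> k < u q"
        using k(2)[OF ij(1)] q True by (auto simp: J_def)
      then have "of_bool (\<rho> i \<in> {l j..<u j}) - of_bool (\<rho> i \<in> {l q..<u q}) =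
          (of_bool (\<rho> i \<in> {u q..<u j}) :: 'a)"
        by (auto simp: of_bool_def)
      moreover have "t q * t q = 1" using t[OF qn] by auto
      then have "B $$ (i, j) =
          s i * t j * (of_bool (\<rho> i \<in> {l j..<u j}) - of_bool (\<rho> i \<in> {l q..<u q}))"
        using True ij entry[OF ij] entry[OF ij(1) qn]
        by (simp add: B_def algebra_simps)
      ultimately show ?thesis using True by (simp add: l'_def)
    next
      case False
      then show ?thesis using ij entry[OF ij] by (auto simp: B_def l'_def)
    qed
    define D where "D = mat_delete B k q"
    \<comment> \<open>\<open>sk a\<close> numbers the indices that remain after deleting
      \<open>a\<close>.\<close>
    define sk where "sk a i = (if i < a then i else Suc i)" for a i :: nat
    have sk: "sk a i < Suc n" if "i < n" for a i using that by (simp add: sk_def)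
    have "det D \<in> {- 1, 0, 1}"
    proof (rule Suc.IH)
      show "D \<in> carrier_mat n n" using B unfolding D_def mat_delete_def by simp
      show "s (sk k i) \<in> {1, - 1}" if "i < n" for i using s sk that by blast
      show "t (sk q j) \<in> {1, - 1}" if "j < n" for j using t sk that by blast
      fix i j assume ij: "i < n" "j < n"
      have "D $$ (i, j) = B $$ (sk k i, sk q j)"
        using B ij unfolding D_def mat_delete_def sk_def by simp
      then show "D $$ (i, j) =
          s (sk k i) * t (sk q j) * of_bool (\<rho> (sk k i) \<in> {l' (sk q j)..<u (sk q j)})"
        using Bentry sk ij by simp
    qed
    moreover have "det B = B $$ (k, q) * cofactor B k q"
    proof -
      \<comment> \<open>For the other \<open>j\<close> in \<open>J\<close> the interval now starts
        at \<open>u q\<close>, beyond \<open>\<rho> k\<close>; columns outside \<open>J\<close>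
        already vanish in row \<open>k\<close>. The expansion thus has a single term.\<close>
      have "B $$ (k, j) * cofactor B k j = 0" if "j < Suc n" "j \<noteq> q" for j
        using Bentry[OF k(1) that(1)] that q(1) by (auto simp: l'_def J_def)
      then have "(\<Sum>j<Suc n. B $$ (k, j) * cofactor B k j) =
          (\<Sum>j\<in>{q}. B $$ (k, j) * cofactor B k j)"
        using qn by (intro sum.mono_neutral_right) auto
      then show ?thesis using laplace_expansion_row[OF B k(1)] by simp
    qed
    moreover have "B $$ (k, q) \<in> {1, - 1}"
      using Bentry[OF k(1) qn] q(1) s[OF k(1)] t[OF qn] by (auto simp: l'_def J_def)
    moreover have "(- 1 :: 'a) ^ (k + q) \<in> {1, - 1}"
      using neg_one_even_power[of "k + q"] neg_one_odd_power[of "k + q"] by blast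
    ultimately show ?thesis
      unfolding detB[symmetric] cofactor_def D_def[symmetric] by auto
  qed
qed

text \<open>Choosing rows and columns only composes the signs, labels and interval ends with
  \<open>pick\<close>, so every square submatrix is again a signed interval matrix.\<close>

lemma totally_unimodular_signed_interval:
  fixes \<rho> :: "nat \<Rightarrow> 'k :: linorder"
  assumes "A \<in> carrier_mat nr nc"
    and "\<And>i. i < nr \<Longrightarrow> s i \<in> {1, - 1}" and "\<And>j. j < nc \<Longrightarrow> t j \<in> {1, - 1}"
    and "\<And>i j. i < nr \<Longrightarrow> j < nc \<Longrightarrow> A $$ (i, j) = s i * t j * of_bool (\<rho> i \<in> {l j..<u j})"
  shows "totally_unimodular A"
  unfolding totally_unimodular_def
proof (intro allI impI)
  fix I J assume I: "I \<subseteq> {..<dim_row A}" and J: "J \<subseteq> {..<dim_col A}" and IJ: "card I = card J"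
  have eqI: "{i. i < dim_row A \<and> i \<in> I} = I" and eqJ: "{j. j < dim_col A \<and> j \<in> J} = J"
    using I J by auto
  have pI: "pick I i < nr" if "i < card I" for i
    using pick_in_set[of i I] that I assms(1) by auto
  have pJ: "pick J j < nc" if "j < card I" for j
    using pick_in_set[of j J] that J IJ assms(1) by auto
  show "det (submatrix A I J) \<in> {- 1, 0, 1}"
  proof (rule det_signed_interval_mat)
    show "submatrix A I J \<in> carrier_mat (card I) (card I)"
      unfolding submatrix_def eqI eqJ using IJ by simp
    show "s (pick I i) \<in> {1, - 1}" if "i < card I" for i using assms(2) pI that by blast
    show "t (pick J j) \<in> {1, - 1}" if "j < card I" for j using assms(3) pJ that by blast
    fix i j assume ij: "i < card I" "j < card I"
    have "submatrix A I J $$ (i, j) = A $$ (pick I i, pick J j)"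
      unfolding submatrix_def eqI eqJ using ij IJ by simp
    then show "submatrix A I J $$ (i, j) =
        s (pick I i) * t (pick J j) * of_bool (\<rho> (pick I i) \<in> {l (pick J j)..<u (pick J j)})"
      using assms(4) pI pJ ij by simp
  qed
qed

section \<open>Application to the matrix \<open>M\<close>\<close>

theorem lemma5p25:
  fixes m r R :: nat
    and \<Lambda> X c \<sigma> w \<tau> :: "nat \<Rightarrow> int"
  assumes "modulus m \<ge> 3" and "r \<ge> 2" and "R = m + r"
    and "\<forall>i\<in>{1..<R}. \<Lambda> (i + 1) \<le> \<Lambda> i" and "\<forall>i\<in>{1..R}. 0 \<le> \<Lambda> i"
    and "\<forall>i\<in>{1..R}. (c i, \<sigma> i) = row_pair m (V R \<Lambda> i)"
    and "\<forall>i\<in>{1..R}. w i = \<sigma> i * V R \<Lambda> i"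
    and "\<forall>j\<in>{1..m}. \<tau> j = 1"
    and "\<forall>j\<in>{1..r}. \<tau> (m + j) = snd (col_pair m (X j))"
  shows
    "(\<forall>(\<pi> :: nat \<Rightarrow> nat) (Mhat :: nat \<Rightarrow> nat \<Rightarrow> int).
        orders_rows R c w \<pi> \<and>
        (\<forall>i\<in>{1..R}. \<forall>j\<in>{1..R}. Mhat (\<pi> i) j = \<sigma> i * \<tau> j * M_entry m r \<Lambda> X i j) \<longrightarrow>
          (\<forall>p\<in>{1..R}. \<forall>j\<in>{1..R}. Mhat p j \<in> {0, 1}) \<and>
          (\<forall>j\<in>{1..R}. \<exists>a b. {p \<in> {1..R}. Mhat p j = 1} = {a..b}))
     \<and> totally_unimodular (M_mat m r \<Lambda> X)"
proof -
  have row: "(c i, \<sigma> i) = row_pair m (V (m + r) \<Lambda> i)" "w i = \<sigma> i * V (m + r) \<Lambda> i"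
    if "i \<in> {1..R}" for i using assms(3,6,7) that by auto
  have Vodd: "odd (V (m + r) \<Lambda> i)" for i by (simp add: V_def)
  have Vpos: "V (m + r) \<Lambda> i > 0" if "i \<in> {1..R}" for i
    using assms(3,5) that by (fastforce simp: V_def)
  have \<sigma>: "\<sigma> i \<in> {1, - 1}" if "i \<in> {1..R}" for i using row_pairD(2)[OF row(1)[OF that]] .
  have col: "(fst (col_pair m (X (j - m))), \<tau> j) = col_pair m (X (j - m))"
    if "j \<in> {1..R}" "\<not> j \<le> m" for j
  proof -
    have "j - m \<in> {1..r}" using that assms(3) by auto
    then show ?thesis using assms(9)[rule_format, of "j - m"] that by simp
  qed
  have \<tau>: "\<tau> j \<in> {1, - 1}" if "j \<in> {1..R}" for j
    using assms(8) that col_pairD(2)[OF col[OF that]] by (cases "j \<le> m") auto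
  \<comment> \<open>\<open>E j d P\<close> records that signed column \<open>j\<close> is the
    indicator of the rows of class \<open>d\<close> whose \<open>w\<close> satisfies the convex
    predicate \<open>P\<close>. Frozen and free columns are treated alike from here on.\<close>
  define E where "E j d P \<longleftrightarrow>
      (\<forall>i\<in>{1..R}. \<sigma> i * \<tau> j * M_entry m r \<Lambda> X i j = of_bool (c i = d \<and> P (w i))) \<and>
      (\<forall>x y z. P x \<longrightarrow> P z \<longrightarrow> x \<le> y \<longrightarrow> y \<le> z \<longrightarrow> P y)" for j d and P :: "int \<Rightarrow> bool"
  have "\<exists>d P. E j d P" if j: "j \<in> {1..R}" for j
  proof (cases "j \<le> m")
    case True
    then show ?thesis
      unfolding E_def using j frozen_entry[OF row(1)] assms(8)
      by (intro exI[of _ "int m - int j + 1"] exI[of _ "\<lambda>_. True"]) auto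
  next
    case False
    let ?x = "X (j - m)"
    let ?b = "fst (col_pair m ?x)"
    \<comment> \<open>This is the condition of \<open>free_entry\<close> with \<open>s * v\<close>
      replaced by \<open>y\<close>. Each conjunct is constant or bounds \<open>y\<close> on one
      side, hence \<open>P\<close> is convex.\<close>
    define P where "P y \<longleftrightarrow> even ?x \<and> ?x + modulus m \<le> \<tau> j * y \<and>
      (?b = 0 \<longrightarrow> - (?x + modulus m) < y)" for y
    have "\<sigma> i * \<tau> j * M_entry m r \<Lambda> X i j = of_bool (c i = ?b \<and> P (w i))" if "i \<in> {1..R}" for i
      using free_entry[OF row(1)[OF that] col[OF j False] Vodd Vpos[OF that]] False row(2)[OF that]
      by (simp add: M_entry_def P_def)
    moreover have "P y" if "P x" "P z" "x \<le> y" "y \<le> z" for x y z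
      using that \<tau>[OF j] by (auto simp: P_def)
    ultimately show ?thesis unfolding E_def by blast
  qed
  then obtain d P where "\<And>j. j \<in> {1..R} \<Longrightarrow> E j (d j) (P j)" by metis
  then have entry: "\<And>i j. j \<in> {1..R} \<Longrightarrow> i \<in> {1..R} \<Longrightarrow>
      \<sigma> i * \<tau> j * M_entry m r \<Lambda> X i j = of_bool (c i = d j \<and> P j (w i))"
    and convex: "\<And>j x y z. j \<in> {1..R} \<Longrightarrow> P j x \<Longrightarrow> P j z \<Longrightarrow> x \<le> y \<Longrightarrow> y \<le> z \<Longrightarrow> P j y"
    unfolding E_def by blast+
  have image: "\<exists>a b. \<pi> ` {i \<in> {1..R}. c i = d j \<and> P j (w i)} = {a..b}"
    if "orders_rows R c w \<pi>" "j \<in> {1..R}" for \<pi> j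
    by (rule orders_rows_convex_image[OF that(1)]) (rule convex[OF that(2)])
  show ?thesis
  proof (intro conjI allI impI)
    fix \<pi> :: "nat \<Rightarrow> nat" and Mhat :: "nat \<Rightarrow> nat \<Rightarrow> int"
    assume *: "orders_rows R c w \<pi> \<and>
      (\<forall>i\<in>{1..R}. \<forall>j\<in>{1..R}. Mhat (\<pi> i) j = \<sigma> i * \<tau> j * M_entry m r \<Lambda> X i j)"
    then have im: "\<pi> ` {1..R} = {1..R}" by (simp add: orders_rows_def permutes_image)
    have Mhat: "Mhat (\<pi> i) j = of_bool (c i = d j \<and> P j (w i))"
      if "i \<in> {1..R}" "j \<in> {1..R}" for i j using * entry that by auto
    show "\<forall>p\<in>{1..R}. \<forall>j\<in>{1..R}. Mhat p j \<in> {0, 1}"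
    proof (intro ballI)
      fix p j assume "p \<in> {1..R}" and j: "j \<in> {1..R}"
      then obtain i where "i \<in> {1..R}" "p = \<pi> i" using im by blast
      then show "Mhat p j \<in> {0, 1}" using Mhat j by (simp add: of_bool_def)
    qed
    show "\<forall>j\<in>{1..R}. \<exists>a b. {p \<in> {1..R}. Mhat p j = 1} = {a..b}"
    proof
      fix j assume j: "j \<in> {1..R}"
      have "{p \<in> {1..R}. Mhat p j = 1} = {p \<in> \<pi> ` {1..R}. Mhat p j = 1}" by (simp only: im)
      also have "\<dots> = \<pi> ` {i \<in> {1..R}. c i = d j \<and> P j (w i)}"
        using Mhat j by (auto simp del: atLeastAtMost_iff)
      finally show "\<exists>a b. {p \<in> {1..R}. Mhat p j = 1} = {a..b}" using image[OF _ j] * by simp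
    qed
  next
    \<comment> \<open>Total unimodularity does not mention an ordering, so one has to be produced.
      The row keys are distinct because the \<open>V R \<Lambda> i\<close> are positive and strictly
      decreasing and \<open>w i\<close> has absolute value \<open>V R \<Lambda> i\<close>.\<close>
    have "\<forall>i\<in>{1..R}. \<sigma> i = snd (row_pair m (V R \<Lambda> i))" using assms(6) by (metis snd_conv)
    then have "inj_on (\<lambda>i. (c i, w i)) {1..R}"
      using inj_on_row_keys[OF assms(4,5) _ assms(7)] by blast
    then obtain \<pi> where \<pi>: "orders_rows R c w \<pi>" using ex1_orders_rows by blast
    then have inj: "inj \<pi>" by (auto simp: orders_rows_def permutes_inj)
    obtain a b where ab: "\<And>j. j \<in> {1..R} \<Longrightarrow>
        \<pi> ` {i \<in> {1..R}. c i = d j \<and> P j (w i)} = {a j..b j}"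
      using image[OF \<pi>] by metis
    show "totally_unimodular (M_mat m r \<Lambda> X)"
    \<comment> \<open>The rows stay in place and receive their positions under \<open>\<pi>\<close>
      as labels, so no permuted matrix is formed.\<close>
    proof (rule totally_unimodular_signed_interval)
      show "M_mat m r \<Lambda> X \<in> carrier_mat R R" by (simp add: M_mat_def assms(3))
      show "\<sigma> (Suc i) \<in> {1, - 1}" "\<tau> (Suc i) \<in> {1, - 1}" if "i < R" for i
        using \<sigma>[of "Suc i"] \<tau>[of "Suc i"] that by auto
      fix i j assume "i < R" "j < R"
      then have i: "Suc i \<in> {1..R}" and j: "Suc j \<in> {1..R}" by auto
      \<comment> \<open>The closed interval of positions becomes half-open with upper end
        \<open>Suc (b (Suc j))\<close>; injectivity of \<open>\<pi>\<close> turns membership in the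
        image into the condition on the row.\<close>
      have "\<pi> (Suc i) \<in> {a (Suc j)..<Suc (b (Suc j))} \<longleftrightarrow> c (Suc i) = d (Suc j) \<and> P (Suc j) (w (Suc i))"
        unfolding atLeastLessThanSuc_atLeastAtMost ab[OF j, symmetric] inj_image_mem_iff[OF inj]
        using i by simp
      then have "\<sigma> (Suc i) * \<tau> (Suc j) * M_entry m r \<Lambda> X (Suc i) (Suc j) =
          of_bool (\<pi> (Suc i) \<in> {a (Suc j)..<Suc (b (Suc j))})"
        using entry[OF j i] by simp
      \<comment> \<open>Signs are their own inverses, so they move from the entry of
        \<open>M\<close> to the indicator.\<close>
      moreover have "\<sigma> (Suc i) * \<sigma> (Suc i) = 1" "\<tau> (Suc j) * \<tau> (Suc j) = 1"
        using \<sigma>[OF i] \<tau>[OF j] by auto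
      ultimately show "M_mat m r \<Lambda> X $$ (i, j) =
          \<sigma> (Suc i) * \<tau> (Suc j) * of_bool (\<pi> (Suc i) \<in> {a (Suc j)..<Suc (b (Suc j))})"
        using \<open>i < R\<close> \<open>j < R\<close> \<sigma>[OF i] \<tau>[OF j] by (auto simp: M_mat_def assms(3))
    qed
  qed
qed

end
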